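(* Write $\Delta_2=\prod_{i=1}^\infty(1-2^{-i})$. Then, as $n\to\infty$, \[ \mathrm{La}(n,O_6)\ \ge\ \left(1+c+o(1)\right)\binom n{\lfloor n/2\rfloor}, \] where \[ c=\Delta_2\sum_{j=1}^{\infty}\frac{2^{-j}}{\left(\prod_{i=1}^{j-1}(2^i-1)\right)^2}>0.22 \] (the empty product, for $j=1$, equals $1$).
   Context: A family $\mathcal G$ of sets is a weak copy of a finite poset $(P,\leqslant)$ if there is a bijection $\psi:P\to\mathcal G$ such that $\psi(p)\subseteq\psi(p')$ whenever $p\leqslant p'$. A family $\mathcal F$ is (weak) $P$-free if no subfamily of it is a weak copy of $P$. $\mathrm{La}(n,P)$ is the maximum size of a weak $P$-free family $\mathcal F\subseteq 2^{[n]}$, where $[n]=\{1,\dots,n\}$ and $2^{[n]}$ is the family of all subsets of $[n]$. The crown poset $O_6$ has six elements $a_1,a_2,a_3,b_{12},b_{13},b_{23}$, whose only strict relations are $a_i<b_{rs}$ if and only if $i\in\{r,s\}$. *)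

theory Defs
  imports "HOL-Analysis.Infinite_Products" "HOL-Library.Landau_Symbols"
begin

(* A finite poset is given by its carrier A and its reflexive order relation r,
   in the sense of partial_order_on A r. *)

definition weak_copy :: "'p set \<Rightarrow> 'p rel \<Rightarrow> 'a set set \<Rightarrow> bool" where
  "weak_copy A r \<G> \<longleftrightarrow> (\<exists>\<psi>. bij_betw \<psi> A \<G> \<and> (\<forall>(p, q) \<in> r. \<psi> p \<subseteq> \<psi> q))"

definition weak_free :: "'p set \<Rightarrow> 'p rel \<Rightarrow> 'a set set \<Rightarrow> bool" where
  "weak_free A r \<F> \<longleftrightarrow> \<not> (\<exists>\<G> \<subseteq> \<F>. weak_copy A r \<G>)"

definition La :: "nat \<Rightarrow> 'p set \<Rightarrow> 'p rel \<Rightarrow> nat" where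
  "La n A r = Max {card \<F> | \<F>. \<F> \<subseteq> Pow {1..n} \<and> weak_free A r \<F>}"

datatype crown6 = A1 | A2 | A3 | B12 | B13 | B23

definition O6 :: "crown6 rel" where
  "O6 = Id \<union> {(A1, B12), (A1, B13), (A2, B12), (A2, B23), (A3, B13), (A3, B23)}"

lemma finite_UNIV_crown6: "finite (UNIV :: crown6 set)"
proof -
  have "(UNIV :: crown6 set) = {A1, A2, A3, B12, B13, B23}"
    using crown6.exhaust by blast
  then show ?thesis by (metis finite.emptyI finite.insertI)
qed

lemma partial_order_O6: "partial_order_on UNIV O6"
  by (auto simp: partial_order_on_def preorder_on_def O6_def intro!: refl_onI transI antisymI)

(* The products and series indexed from 1 are shifted to start at 0. *)

definition Delta2 :: real where
  "Delta2 = (\<Prod>i. (1 - 1 / 2 ^ Suc i))"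

definition crown_const :: real where
  "crown_const = Delta2 * (\<Sum>j. (1 / 2 ^ Suc j) / (\<Prod>i=1..j. (2 ^ i - 1))\<^sup>2)"

end

theory Submission
  imports Defs
begin

text \<open>
  Label the ground set by vectors \<open>f i\<close> of a \<open>D\<close>-dimensional space over the field with two
  elements, where \<open>D = m + 1\<close> and \<open>m = \<lfloor>n/2\<rfloor>\<close>, and fix a vector \<open>x\<close>.  Take the \<open>m\<close>-sets \<open>S\<close> with
  \<open>x \<notin> span f(S)\<close> and the \<open>(m + 1)\<close>-sets \<open>T\<close> with \<open>x \<in> span f(T)\<close>.  A crown in two
  consecutive levels has the form \<open>S + p, S + q, S + r\<close> below \<open>S + p + q, S + p + r, S + q + r\<close>;
  modulo \<open>W = span f(S)\<close> the conditions give \<open>x = f p + f q = f p + f r = f q + f r\<close>, and adding up,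
  \<open>x = 0\<close>, that is \<open>x \<in> W\<close>, which is excluded.

  Averaging over all \<open>f\<close> and \<open>x\<close>, the family has density \<open>1 - q\<^sub>m\<close> on level \<open>m\<close> and
  \<open>q\<^sub>m\<^sub>+\<^sub>1\<close> on level \<open>m + 1\<close>, where \<open>q\<^sub>t\<close> is the expectation of \<open>|span| / 2\<^sup>D\<close> for \<open>t\<close> random
  vectors.  One more random vector adds \<open>E[2\<^sup>-\<^sup>j (1 - 2\<^sup>-\<^sup>j)]\<close>, with \<open>j\<close> the codimension of the
  span of \<open>m\<close> vectors; the distribution of \<open>j\<close> is explicit, and the summand for \<open>j\<close> tends to
  the \<open>j\<close>-th summand of the constant.  Only a lower bound is needed, so finitely many \<open>j\<close> suffice.

  Vectors are natural numbers below \<open>2\<^sup>D\<close>, added by bitwise exclusive or.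
\<close>

section \<open>Spans over the two-element field\<close>

lemma xor_less_two_power:
  fixes a b :: nat
  assumes "a < 2 ^ D" "b < 2 ^ D"
  shows "xor a b < 2 ^ D"
  using assms take_bit_nat_eq_self_iff take_bit_xor by metis

lemma xor_cancel_left [simp]: "xor x (xor x y) = y" for x y :: nat
  by (simp flip: xor.assoc)

lemma inj_xor: "inj (xor x)" for x :: nat
  by (metis injI xor_cancel_left)

text \<open>Over the two-element field the only scalars are 0 and 1, so closing 0 under addition of
  generators already yields the linear span. Generators are indexed, so repeated vectors need no
  special care.\<close>

inductive_set xor_span :: "('i \<Rightarrow> nat) \<Rightarrow> 'i set \<Rightarrow> nat set" for f T where
  zero: "0 \<in> xor_span f T"
| step: "i \<in> T \<Longrightarrow> a \<in> xor_span f T \<Longrightarrow> xor (f i) a \<in> xor_span f T"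

lemma xor_span_closed:
  "a \<in> xor_span f T \<Longrightarrow> b \<in> xor_span f T \<Longrightarrow> xor a b \<in> xor_span f T"
  by (induction a rule: xor_span.induct) (auto simp: xor.assoc intro: xor_span.step)

lemma xor_span_mono: "S \<subseteq> T \<Longrightarrow> xor_span f S \<subseteq> xor_span f T"
proof
  fix a assume "S \<subseteq> T" "a \<in> xor_span f S"
  then show "a \<in> xor_span f T"
    by (induction rule: xor_span.induct[OF \<open>a \<in> xor_span f S\<close>]) (auto intro: xor_span.intros)
qed

lemma xor_span_empty [simp]: "xor_span f {} = {0}"
proof -
  have "a = 0" if "a \<in> xor_span f {}" for a
    using that by cases auto
  then show ?thesis by (auto intro: xor_span.zero)
qed

lemma xor_span_cong:
  assumes "\<And>i. i \<in> T \<Longrightarrow> f i = g i"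
  shows "xor_span f T = xor_span g T"
proof -
  have "xor_span f T \<subseteq> xor_span g T" if "\<And>i. i \<in> T \<Longrightarrow> f i = g i" for f g :: "'a \<Rightarrow> nat"
  proof
    fix a assume "a \<in> xor_span f T"
    then show "a \<in> xor_span g T"
      by (induction rule: xor_span.induct) (use that in \<open>auto intro: xor_span.intros\<close>)
  qed
  with assms show ?thesis by (metis subset_antisym)
qed

lemma xor_span_less:
  assumes "\<And>i. i \<in> T \<Longrightarrow> f i < 2 ^ D"
  shows "xor_span f T \<subseteq> {..<2 ^ D}"
proof
  fix a assume "a \<in> xor_span f T"
  then show "a \<in> {..<2 ^ D}"
    by (induction rule: xor_span.induct) (use assms in \<open>auto intro: xor_less_two_power\<close>)
qed

lemma xor_span_insert:
  "xor_span f (insert i T) = xor_span f T \<union> xor (f i) ` xor_span f T"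
proof
  show "xor_span f (insert i T) \<subseteq> xor_span f T \<union> xor (f i) ` xor_span f T"
  proof
    fix a assume "a \<in> xor_span f (insert i T)"
    then show "a \<in> xor_span f T \<union> xor (f i) ` xor_span f T"
    proof (induction rule: xor_span.induct)
      case zero
      show ?case by (simp add: xor_span.zero)
    next
      case (step j a)
      show ?case
      proof (cases "j = i")
        case True
        with step.IH show ?thesis by auto
      next
        case False
        with step.hyps have "j \<in> T" by simp
        from step.IH show ?thesis
        proof
          assume "a \<in> xor_span f T"
          with \<open>j \<in> T\<close> show ?thesis by (auto intro: xor_span.step)
        next
          assume "a \<in> xor (f i) ` xor_span f T"
          then obtain b where b: "b \<in> xor_span f T" "a = xor (f i) b" by auto
          have "xor (f j) a = xor (f i) (xor (f j) b)"
            using b by (simp add: xor.left_commute)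
          with b \<open>j \<in> T\<close> show ?thesis by (auto intro: xor_span.step)
        qed
      qed
    qed
  qed
next
  show "xor_span f T \<union> xor (f i) ` xor_span f T \<subseteq> xor_span f (insert i T)"
    using xor_span_mono[of T "insert i T" f] by (auto intro: xor_span.step)
qed

text \<open>Adding \<open>f i\<close> is an involution. This form turns membership in a larger span
  into conditions modulo the smaller one.\<close>

lemma mem_xor_span_insert:
  "x \<in> xor_span f (insert i T) \<longleftrightarrow> x \<in> xor_span f T \<or> xor (f i) x \<in> xor_span f T"
  unfolding xor_span_insert by (auto simp: image_iff) (metis xor_cancel_left)

text \<open>The coset of the old span through \<open>f i\<close> either equals that span or is
  disjoint from it.\<close>

lemma card_xor_span_insert:
  assumes "finite (xor_span f T)"
  shows "card (xor_span f (insert i T)) =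
    (if f i \<in> xor_span f T then card (xor_span f T) else 2 * card (xor_span f T))"
proof (cases "f i \<in> xor_span f T")
  case True
  then have "xor (f i) ` xor_span f T \<subseteq> xor_span f T"
    by (auto intro: xor_span_closed)
  with True show ?thesis by (simp add: xor_span_insert Un_absorb2)
next
  case False
  have "xor_span f T \<inter> xor (f i) ` xor_span f T = {}"
  proof (rule ccontr)
    assume "\<not> ?thesis"
    then obtain b where "b \<in> xor_span f T" "xor (f i) b \<in> xor_span f T" by auto
    then have "xor b (xor b (f i)) \<in> xor_span f T"
      by (metis xor_span_closed xor.commute)
    with False show False by simp
  qed
  then have "card (xor_span f (insert i T)) =
      card (xor_span f T) + card (xor (f i) ` xor_span f T)"
    unfolding xor_span_insert using assms by (simp add: card_Un_disjoint)
  also have "card (xor (f i) ` xor_span f T) = card (xor_span f T)"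
    by (rule card_image) (meson inj_xor inj_on_subset subset_UNIV)
  finally show ?thesis using False by simp
qed

text \<open>The exponent \<open>a\<close> serves as the rank, in place of a separate notion of
  dimension.\<close>

lemma card_xor_span_power:
  assumes "finite T"
  shows "finite (xor_span f T) \<and> (\<exists>a\<le>card T. card (xor_span f T) = 2 ^ a)"
  using assms
proof (induction T)
  case empty
  show ?case by simp
next
  case (insert i T)
  then obtain a where a: "a \<le> card T" "card (xor_span f T) = 2 ^ a" by blast
  have "finite (xor_span f (insert i T))"
    using insert.IH by (simp add: xor_span_insert)
  moreover have "card (xor_span f (insert i T)) \<in> {2 ^ a, 2 ^ Suc a}"
    using insert.IH a by (simp add: card_xor_span_insert)
  ultimately show ?case
    using a insert.hyps by (auto intro: exI[of _ a] exI[of _ "Suc a"])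
qed

section \<open>The crown-free family on two consecutive levels\<close>

definition crown_free_family :: "nat \<Rightarrow> nat \<Rightarrow> (nat \<Rightarrow> nat) \<Rightarrow> nat \<Rightarrow> nat set set" where
  "crown_free_family n m f x =
    {S. S \<subseteq> {1..n} \<and> card S = m \<and> x \<notin> xor_span f S} \<union>
    {T. T \<subseteq> {1..n} \<and> card T = Suc m \<and> x \<in> xor_span f T}"

text \<open>The assumption \<open>distinct\<close> excludes three \<open>m\<close>-subsets of a common \<open>(m + 1)\<close>-set.\<close>

lemma three_sets_sunflower:
  assumes fin: "finite a1" "finite a2" "finite a3"
    and card: "card a1 = m" "card a2 = m" "card a3 = m"
    and un: "card (a1 \<union> a2) = Suc m" "card (a1 \<union> a3) = Suc m" "card (a2 \<union> a3) = Suc m"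
    and distinct: "a1 \<union> a2 \<noteq> a1 \<union> a3"
  obtains S p q r where "a1 = insert p S" "a2 = insert q S" "a3 = insert r S"
proof -
  define S where "S = a1 \<inter> a2"
  have cS: "Suc (card S) = m"
    using card_Un_Int[of a1 a2] fin card un by (simp add: S_def)
  have ext: "\<exists>p. a = insert p S" if "S \<subseteq> a" "finite a" "card a = m" for a
  proof -
    have "card (a - S) = 1"
      using that cS by (simp add: card_Diff_subset finite_subset)
    then obtain p where "a - S = {p}" by (auto simp: card_1_singleton_iff)
    with that(1) show ?thesis by blast
  qed
  have "\<not> a3 \<subseteq> a1 \<union> a2"
  proof
    assume "a3 \<subseteq> a1 \<union> a2"
    then have "a1 \<union> a3 \<subseteq> a1 \<union> a2" by blast
    then have "a1 \<union> a3 = a1 \<union> a2"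
      using un fin by (intro card_subset_eq) auto
    with distinct show False by simp
  qed
  then obtain r where r: "r \<in> a3" "r \<notin> a1" "r \<notin> a2" by blast
  have "insert r a1 = a1 \<union> a3"
    using un fin card r by (intro card_subset_eq) auto
  moreover have "insert r a2 = a2 \<union> a3"
    using un fin card r by (intro card_subset_eq) auto
  ultimately have "a3 \<subseteq> insert r S"
    unfolding S_def by blast
  moreover have "card (insert r S) = m"
    using cS r fin by (simp add: S_def)
  ultimately have "a3 = insert r S"
    using card fin by (intro card_subset_eq) (auto simp: S_def)
  then show ?thesis
    using that ext[of a1] ext[of a2] fin card by (auto simp: S_def)
qed

text \<open>Strict inclusions force the three lower members of a copy into level \<open>m\<close>
  and the three upper ones into level \<open>Suc m\<close>. The upper ones are then the pairwise
  unions of the lower ones, and the parity argument applies.\<close>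

lemma weak_free_crown_free_family: "weak_free UNIV O6 (crown_free_family n m f x)"
  unfolding weak_free_def
proof
  let ?F = "crown_free_family n m f x"
  assume "\<exists>\<G>\<subseteq>?F. weak_copy UNIV O6 \<G>"
  then obtain \<G> \<psi> where sub: "\<G> \<subseteq> ?F" and bij: "bij_betw \<psi> UNIV \<G>"
    and mono: "\<And>p q. (p, q) \<in> O6 \<Longrightarrow> \<psi> p \<subseteq> \<psi> q"
    unfolding weak_copy_def by blast
  have inj: "inj \<psi>" using bij by (rule bij_betw_imp_inj_on)
  have F: "\<psi> p \<in> ?F" for p using bij sub by (auto simp: bij_betw_def)
  have fin: "finite (\<psi> p)" for p
    using F[of p] by (auto simp: crown_free_family_def intro: finite_subset)
  have rel: "card (\<psi> p) = m \<and> x \<notin> xor_span f (\<psi> p) \<and>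
      card (\<psi> q) = Suc m \<and> x \<in> xor_span f (\<psi> q)"
    if "(p, q) \<in> O6" "p \<noteq> q" for p q
  proof -
    have "\<psi> p \<subset> \<psi> q"
      using mono[OF that(1)] that(2) inj by (auto dest: injD)
    then have "card (\<psi> p) < card (\<psi> q)" by (simp add: fin psubset_card_mono)
    then show ?thesis
      using F[of p] F[of q] by (auto simp: crown_free_family_def)
  qed
  note r12 = rel[of A1 B12] rel[of A2 B12] mono[of A1 B12] mono[of A2 B12]
  note r13 = rel[of A1 B13] rel[of A3 B13] mono[of A1 B13] mono[of A3 B13]
  note r23 = rel[of A2 B23] rel[of A3 B23] mono[of A2 B23] mono[of A3 B23]
  \<comment> \<open>Two distinct \<open>m\<close>-sets have more than \<open>m\<close> elements in
    their union, so inside an \<open>(m + 1)\<close>-set they fill it.\<close>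
  have join: "a \<union> b = c"
    if "a \<noteq> b" "a \<subseteq> c" "b \<subseteq> c" "card a = m" "card b = m" "card c = Suc m" "finite c"
    for a b c :: "nat set"
  proof (rule card_subset_eq)
    have "finite a" "finite b" using that finite_subset by auto
    then have "a \<subset> a \<union> b" using that card_subset_eq[of a b] by auto
    then have "m < card (a \<union> b)"
      using \<open>finite a\<close> \<open>finite b\<close> that psubset_card_mono[of "a \<union> b" a] by simp
    moreover have "card (a \<union> b) \<le> card c" using that by (intro card_mono) auto
    ultimately show "card (a \<union> b) = card c" using that by simp
  qed (use that in auto)
  have ne: "\<psi> p \<noteq> \<psi> q" if "p \<noteq> q" for p q using that inj by (auto dest: injD)
  have b: "\<psi> A1 \<union> \<psi> A2 = \<psi> B12" "\<psi> A1 \<union> \<psi> A3 = \<psi> B13" "\<psi> A2 \<union> \<psi> A3 = \<psi> B23"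
    by (rule join; use r12 r13 r23 ne[of A1 A2] ne[of A1 A3] ne[of A2 A3] fin in
        \<open>simp add: O6_def\<close>)+
  obtain S p q r where S: "\<psi> A1 = insert p S" "\<psi> A2 = insert q S" "\<psi> A3 = insert r S"
    by (rule three_sets_sunflower[of "\<psi> A1" "\<psi> A2" "\<psi> A3" m])
      (use r12 r13 r23 ne[of B12 B13] in \<open>auto simp: O6_def b fin\<close>)
  have no: "x \<notin> xor_span f (insert i S)" if "i \<in> {p, q, r}" for i
    using r12 r13 r23 that by (auto simp: O6_def S)
  have yes: "x \<in> xor_span f (insert i (insert j S))" if "(i, j) \<in> {(p, q), (p, r), (q, r)}" for i j
  proof -
    have "insert i (insert j S) \<in> {\<psi> B12, \<psi> B13, \<psi> B23}"
      using that by (auto simp flip: b simp: S)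
    then show ?thesis using r12 r13 r23 by (auto simp: O6_def)
  qed
  \<comment> \<open>Membership of \<open>x\<close> in the span of \<open>S\<close> with
    \<open>i\<close> and \<open>j\<close> leaves four cases modulo the span of \<open>S\<close>;
    \<open>no\<close> rules out all but the one using both vectors.\<close>
  have two: "xor (f i) (xor (f j) x) \<in> xor_span f S"
    if "(i, j) \<in> {(p, q), (p, r), (q, r)}" for i j
    using yes[OF that] no[of i] no[of j] that
    by (auto simp: mem_xor_span_insert xor.left_commute)
  \<comment> \<open>Each of \<open>f p\<close>, \<open>f q\<close>, \<open>f r\<close> occurs twice
    and cancels, while \<open>x\<close> occurs three times and survives.\<close>
  have "xor (xor (f p) (xor (f q) x)) (xor (xor (f p) (xor (f r) x)) (xor (f q) (xor (f r) x)))
      \<in> xor_span f S"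
    by (intro xor_span_closed two) auto
  moreover have "xor (xor (f p) (xor (f q) x)) (xor (xor (f p) (xor (f r) x)) (xor (f q) (xor (f r) x))) = x"
    by (simp add: xor.assoc xor.left_commute xor.commute)
  ultimately show False
    using no[of p] by (auto simp: mem_xor_span_insert)
qed

lemma card_le_La:
  assumes "\<F> \<subseteq> Pow {1..n}" "weak_free A r \<F>"
  shows "card \<F> \<le> La n A r"
  unfolding La_def
proof (rule Max_ge)
  have "{card \<F> |\<F>. \<F> \<subseteq> Pow {1..n} \<and> weak_free A r \<F>} \<subseteq> card ` Pow (Pow {1..n})" by auto
  then show "finite {card \<F> |\<F>. \<F> \<subseteq> Pow {1..n} \<and> weak_free A r \<F>}"
    by (rule finite_subset) simp
qed (use assms in auto)

section \<open>Random labellings\<close>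

text \<open>Extensionality makes this set finite, so sums over it, divided by its cardinality, act
  as expectations over independent uniform vectors.\<close>

definition labellings :: "nat \<Rightarrow> nat \<Rightarrow> (nat \<Rightarrow> nat) set" where
  "labellings n D = {1..n} \<rightarrow>\<^sub>E {..<2 ^ D}"

lemma labellings_nonempty: "card (labellings n D) > 0"
  by (simp add: labellings_def card_PiE)

lemma xor_span_labelling_subset:
  "f \<in> labellings n D \<Longrightarrow> T \<subseteq> {1..n} \<Longrightarrow> xor_span f T \<subseteq> {..<2 ^ D}"
  by (rule xor_span_less) (auto simp: labellings_def)

text \<open>Redrawing one coordinate preserves the uniform distribution: swapping \<open>f i\<close>
  with the fresh value \<open>v\<close> is an involution on the pairs \<open>(f, v)\<close>.\<close>

lemma sum_labellings_resample:
  fixes G :: "(nat \<Rightarrow> nat) \<Rightarrow> real"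
  assumes "i \<in> {1..n}"
  shows "(\<Sum>f\<in>labellings n D. \<Sum>v<2 ^ D. G (f(i := v))) = 2 ^ D * (\<Sum>f\<in>labellings n D. G f)"
proof -
  let ?X = "labellings n D \<times> {..<2 ^ D :: nat}"
  have *: "(f(i := v), f i) \<in> ?X" if "(f, v) \<in> ?X" for f v
  proof -
    have "f(i := v) \<in> labellings n D"
      unfolding labellings_def PiE_iff
    proof
      show "\<forall>j\<in>{1..n}. (f(i := v)) j \<in> {..<2 ^ D}"
        using that by (auto simp: labellings_def)
      show "f(i := v) \<in> extensional {1..n}"
        using that assms by (auto simp: labellings_def PiE_iff extensional_def)
    qed
    moreover have "f i \<in> {..<2 ^ D}"
      using that assms by (auto simp: labellings_def)
    ultimately show ?thesis by simp
  qed
  have "(\<Sum>f\<in>labellings n D. \<Sum>v<2 ^ D. G (f(i := v))) = (\<Sum>(f, v)\<in>?X. G (f(i := v)))"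
    by (simp add: sum.cartesian_product)
  also have "\<dots> = (\<Sum>(f, v)\<in>?X. G f)"
    by (rule sum.reindex_bij_witness[where i = "\<lambda>(f, v). (f(i := v), f i)"
          and j = "\<lambda>(f, v). (f(i := v), f i)"]) (use * in auto)
  also have "\<dots> = 2 ^ D * (\<Sum>f\<in>labellings n D. G f)"
    by (simp add: sum_distrib_left flip: sum.cartesian_product)
  finally show ?thesis .
qed

text \<open>One step of the Markov chain of span sizes, scaled by \<open>2 ^ D\<close>: the new
  vector falls into the old span \<open>W\<close> with probability \<open>|W| / 2 ^ D\<close>, and
  otherwise doubles it.\<close>

lemma sum_labellings_insert:
  fixes \<phi> :: "nat \<Rightarrow> real"
  assumes T: "insert i T \<subseteq> {1..n}" "i \<notin> T"
  shows "2 ^ D * (\<Sum>f\<in>labellings n D. \<phi> (card (xor_span f (insert i T)))) =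
    (\<Sum>f\<in>labellings n D. card (xor_span f T) * \<phi> (card (xor_span f T)) +
       (2 ^ D - real (card (xor_span f T))) * \<phi> (2 * card (xor_span f T)))"
proof -
  have "(\<Sum>v<2 ^ D. \<phi> (card (xor_span (f(i := v)) (insert i T)))) =
      card (xor_span f T) * \<phi> (card (xor_span f T)) +
      (2 ^ D - real (card (xor_span f T))) * \<phi> (2 * card (xor_span f T))"
    if f: "f \<in> labellings n D" for f
  proof -
    let ?W = "xor_span f T"
    have W: "?W \<subseteq> {..<2 ^ D}"
      using xor_span_labelling_subset[OF f] T by auto
    then have fin: "finite ?W" by (rule finite_subset) simp
    have "xor_span (f(i := v)) T = ?W" for v
      using T(2) by (intro xor_span_cong) auto
    then have "(\<Sum>v<2 ^ D. \<phi> (card (xor_span (f(i := v)) (insert i T)))) =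
        (\<Sum>v<2 ^ D. if v \<in> ?W then \<phi> (card ?W) else \<phi> (2 * card ?W))"
      using fin by (intro sum.cong) (simp_all add: card_xor_span_insert)
    also have "\<dots> = card ?W * \<phi> (card ?W) + card ({..<2 ^ D} - ?W) * \<phi> (2 * card ?W)"
      using W by (simp add: sum.If_cases Int_absorb1 Diff_eq)
    also have "real (card ({..<2 ^ D} - ?W)) = 2 ^ D - real (card ?W)"
      using W card_mono[OF _ W] by (simp add: card_Diff_subset[OF fin] of_nat_diff)
    finally show ?thesis .
  qed
  then show ?thesis
    using T sum_labellings_resample[of i n "\<lambda>f. \<phi> (card (xor_span f (insert i T)))" D] by simp
qed

section \<open>Distribution of the rank of random vectors\<close>

fun gauss_binom2 :: "nat \<Rightarrow> nat \<Rightarrow> real" where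
  "gauss_binom2 t 0 = 1"
| "gauss_binom2 0 (Suc a) = 0"
| "gauss_binom2 (Suc t) (Suc a) = 2 ^ Suc a * gauss_binom2 t (Suc a) + gauss_binom2 t a"

text \<open>The classical proportion of rank \<open>a\<close> among the \<open>D\<close> by
  \<open>t\<close> matrices over the two-element field; \<open>gauss_binom2\<close> is the Gaussian
  binomial coefficient at q = 2, given by its Pascal recurrence.\<close>

definition rank_prob :: "nat \<Rightarrow> nat \<Rightarrow> nat \<Rightarrow> real" where
  "rank_prob D t a = gauss_binom2 t a * (\<Prod>i<a. 2 ^ D - 2 ^ i) / 2 ^ (D * t)"

lemma gauss_binom2_nonneg: "gauss_binom2 t a \<ge> 0"
  by (induction t a rule: gauss_binom2.induct) auto

lemma rank_prob_nonneg: "a \<le> D \<Longrightarrow> rank_prob D t a \<ge> 0"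
  unfolding rank_prob_def
  by (intro divide_nonneg_nonneg mult_nonneg_nonneg prod_nonneg gauss_binom2_nonneg) auto

text \<open>Rank \<open>a\<close> arises from rank \<open>a\<close> by a vector inside the span or
  from rank \<open>a - 1\<close> by one outside; with the common factors removed this is the Pascal
  recurrence.\<close>

lemma rank_distribution:
  assumes "finite T" "T \<subseteq> {1..n}"
  shows "(\<Sum>f\<in>labellings n D. of_bool (card (xor_span f T) = 2 ^ a)) =
    rank_prob D (card T) a * card (labellings n D)"
  using assms
proof (induction T arbitrary: a)
  case empty
  show ?case by (cases a) (auto simp: rank_prob_def)
next
  case (insert i T)
  let ?N = "\<lambda>T a. \<Sum>f\<in>labellings n D. of_bool (card (xor_span f T) = 2 ^ a) :: real"
  have IH: "?N T a = rank_prob D (card T) a * card (labellings n D)" for a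
    using insert by auto
  have pos: "card (xor_span f T) > 0" for f
    using card_xor_span_power[OF insert.hyps(1), of f] by auto
  have "2 ^ D * ?N (insert i T) a =
      (\<Sum>f\<in>labellings n D. real (card (xor_span f T)) * of_bool (card (xor_span f T) = 2 ^ a) +
         (2 ^ D - real (card (xor_span f T))) * of_bool (2 * card (xor_span f T) = 2 ^ a))"
    using insert by (intro sum_labellings_insert) auto
  also have "\<dots> = 2 ^ D * (rank_prob D (card (insert i T)) a * card (labellings n D))"
  proof (cases a)
    case 0
    have "(\<Sum>f\<in>labellings n D. real (card (xor_span f T)) * of_bool (card (xor_span f T) = 2 ^ a) +
         (2 ^ D - real (card (xor_span f T))) * of_bool (2 * card (xor_span f T) = 2 ^ a)) = ?N T 0"
      using 0 by (intro sum.cong) auto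
    also have "\<dots> = 2 ^ D * (rank_prob D (card (insert i T)) a * card (labellings n D))"
      unfolding IH using 0 insert.hyps by (simp add: rank_prob_def power_add)
    finally show ?thesis .
  next
    case (Suc b)
    have "(\<Sum>f\<in>labellings n D. real (card (xor_span f T)) * of_bool (card (xor_span f T) = 2 ^ a) +
         (2 ^ D - real (card (xor_span f T))) * of_bool (2 * card (xor_span f T) = 2 ^ a)) =
       2 ^ a * ?N T a + (2 ^ D - 2 ^ b) * ?N T b"
      unfolding sum_distrib_left sum.distrib[symmetric] using Suc
      by (intro sum.cong) auto
    also have "\<dots> = 2 ^ D * (rank_prob D (card (insert i T)) a * card (labellings n D))"
      unfolding IH using Suc insert.hyps
      by (simp add: rank_prob_def power_add field_simps)
    finally show ?thesis .
  qed
  finally show ?case by simp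
qed

text \<open>Span sizes are powers of two, so any function of the size splits into indicators of
  ranks.\<close>

lemma sum_labellings_card_span:
  fixes \<phi> :: "nat \<Rightarrow> real"
  assumes "T \<subseteq> {1..n}"
  shows "(\<Sum>f\<in>labellings n D. \<phi> (card (xor_span f T))) =
    card (labellings n D) * (\<Sum>a\<le>card T. rank_prob D (card T) a * \<phi> (2 ^ a))"
proof -
  have fin: "finite T" using assms finite_subset by auto
  have "\<phi> (card (xor_span f T)) =
      (\<Sum>a\<le>card T. of_bool (card (xor_span f T) = 2 ^ a) * \<phi> (2 ^ a))" for f
  proof -
    obtain b where b: "b \<le> card T" "card (xor_span f T) = 2 ^ b"
      using card_xor_span_power[OF fin, of f] by blast
    have "(\<Sum>a\<le>card T. of_bool (card (xor_span f T) = 2 ^ a) * \<phi> (2 ^ a)) =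
        (\<Sum>a\<le>card T. if a = b then \<phi> (2 ^ a) else 0)"
      using b by (intro sum.cong) auto
    then show ?thesis using b by simp
  qed
  then have "(\<Sum>f\<in>labellings n D. \<phi> (card (xor_span f T))) =
      (\<Sum>f\<in>labellings n D. \<Sum>a\<le>card T. of_bool (card (xor_span f T) = 2 ^ a) * \<phi> (2 ^ a))"
    by simp
  also have "\<dots> = (\<Sum>a\<le>card T. (\<Sum>f\<in>labellings n D. of_bool (card (xor_span f T) = 2 ^ a)) * \<phi> (2 ^ a))"
    by (subst sum.swap) (simp add: sum_distrib_right)
  also have "\<dots> = card (labellings n D) * (\<Sum>a\<le>card T. rank_prob D (card T) a * \<phi> (2 ^ a))"
    unfolding rank_distribution[OF fin assms] by (simp add: sum_distrib_left mult_ac)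
  finally show ?thesis .
qed

section \<open>Expected density of the span and its growth\<close>

definition mean_density :: "nat \<Rightarrow> nat \<Rightarrow> real" where
  "mean_density D t = (\<Sum>a\<le>t. rank_prob D t a * (2 ^ a / 2 ^ D))"

text \<open>The expectation of \<open>p * (1 - p)\<close>, where \<open>p\<close> is the random
  density of the span of \<open>t\<close> vectors.\<close>

definition density_gain :: "nat \<Rightarrow> nat \<Rightarrow> real" where
  "density_gain D t = (\<Sum>a\<le>t. rank_prob D t a * (2 ^ a / 2 ^ D * (1 - 2 ^ a / 2 ^ D)))"

lemma sum_card_span:
  assumes "T \<subseteq> {1..n}"
  shows "(\<Sum>f\<in>labellings n D. real (card (xor_span f T))) =
    card (labellings n D) * 2 ^ D * mean_density D (card T)"
  using sum_labellings_card_span[OF assms, of real D]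
  by (simp add: mean_density_def sum_distrib_left mult_ac)

text \<open>Taken from the meaning as an average of span densities, with \<open>{1..t}\<close> as
  sample, rather than from the formula.\<close>

lemma mean_density_le_1: "mean_density D t \<le> 1"
proof -
  have "(\<Sum>f\<in>labellings t D. real (card (xor_span f {1..t}))) \<le> (\<Sum>f\<in>labellings t D. 2 ^ D)"
  proof (rule sum_mono)
    fix f assume "f \<in> labellings t D"
    then have "card (xor_span f {1..t}) \<le> card {..<2 ^ D :: nat}"
      by (intro card_mono xor_span_labelling_subset) auto
    then have "card (xor_span f {1..t}) \<le> 2 ^ D" by simp
    then show "real (card (xor_span f {1..t})) \<le> 2 ^ D" using of_nat_mono by fastforce
  qed
  then show ?thesis
    using labellings_nonempty[of t D] by (simp add: sum_card_span)
qed

text \<open>A span of density \<open>p\<close> is doubled with probability \<open>1 - p\<close>, so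
  the expected increase is \<open>p * (1 - p)\<close>.\<close>

lemma mean_density_Suc: "mean_density D (Suc t) = mean_density D t + density_gain D t"
proof -
  let ?L = "labellings (Suc t) D"
  let ?c = "\<lambda>f. real (card (xor_span f {1..t}))"
  have "2 ^ D * (\<Sum>f\<in>?L. real (card (xor_span f (insert (Suc t) {1..t})))) =
      (\<Sum>f\<in>?L. ?c f * ?c f + (2 ^ D - ?c f) * (2 * ?c f))"
    by (subst sum_labellings_insert[where \<phi> = real]) auto
  also have "\<dots> = (\<Sum>f\<in>?L. 2 ^ D * ?c f + ?c f * (2 ^ D - ?c f))"
    by (simp add: algebra_simps)
  also have "\<dots> = 2 ^ D * (\<Sum>f\<in>?L. ?c f) + (\<Sum>f\<in>?L. ?c f * (2 ^ D - ?c f))"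
    by (simp add: sum.distrib sum_distrib_left)
  also have "(\<Sum>f\<in>?L. ?c f * (2 ^ D - ?c f)) = card ?L * 2 ^ D * 2 ^ D * density_gain D t"
  proof -
    have "real (2 ^ a) * (2 ^ D - real (2 ^ a)) =
        2 ^ D * 2 ^ D * (2 ^ a / 2 ^ D * (1 - 2 ^ a / 2 ^ D))" for a
      by (simp add: field_simps)
    then show ?thesis
      using sum_labellings_card_span[of "{1..t}" "Suc t" "\<lambda>c. real c * (2 ^ D - real c)" D]
      by (simp add: density_gain_def sum_distrib_left mult_ac)
  qed
  finally have "card ?L * (2 ^ D * 2 ^ D) * mean_density D (Suc t) =
      card ?L * (2 ^ D * 2 ^ D) * (mean_density D t + density_gain D t)"
    by (simp add: sum_card_span algebra_simps)
  then show ?thesis using labellings_nonempty[of "Suc t" D] by auto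
qed

section \<open>Averaging the family over labellings and vectors\<close>

lemma sum_card_crown_free_family:
  assumes f: "f \<in> labellings n D"
  shows "(\<Sum>x<2 ^ D. real (card (crown_free_family n m f x))) =
    (\<Sum>S | S \<subseteq> {1..n} \<and> card S = m. 2 ^ D - real (card (xor_span f S))) +
    (\<Sum>T | T \<subseteq> {1..n} \<and> card T = Suc m. real (card (xor_span f T)))"
proof -
  let ?P = "\<lambda>k. {S. S \<subseteq> {1..n} \<and> card S = k}"
  have fin: "finite (?P k)" for k by (rule finite_subset[of _ "Pow {1..n}"]) auto
  have "real (card (crown_free_family n m f x)) =
      (\<Sum>S\<in>?P m. of_bool (x \<notin> xor_span f S)) + (\<Sum>T\<in>?P (Suc m). of_bool (x \<in> xor_span f T))" for x
  proof -
    have "crown_free_family n m f x =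
        (?P m \<inter> {S. x \<notin> xor_span f S}) \<union> (?P (Suc m) \<inter> {T. x \<in> xor_span f T})"
      by (auto simp: crown_free_family_def)
    moreover have "(?P m \<inter> {S. x \<notin> xor_span f S}) \<inter> (?P (Suc m) \<inter> {T. x \<in> xor_span f T}) = {}"
      by auto
    ultimately show ?thesis
      using fin by (simp add: card_Un_disjoint sum_of_bool_eq)
  qed
  then have "(\<Sum>x<2 ^ D. real (card (crown_free_family n m f x))) =
      (\<Sum>S\<in>?P m. \<Sum>x<2 ^ D. of_bool (x \<notin> xor_span f S)) +
      (\<Sum>T\<in>?P (Suc m). \<Sum>x<2 ^ D. of_bool (x \<in> xor_span f T))"
    by (simp only: sum.distrib sum.swap[of _ "?P m"] sum.swap[of _ "?P (Suc m)"])
  also have "(\<Sum>S\<in>?P m. \<Sum>x<2 ^ D. of_bool (x \<notin> xor_span f S)) =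
      (\<Sum>S\<in>?P m. 2 ^ D - real (card (xor_span f S)))"
  proof (rule sum.cong[OF refl])
    fix S assume "S \<in> ?P m"
    then have W: "xor_span f S \<subseteq> {..<2 ^ D}" using xor_span_labelling_subset[OF f] by auto
    have "{..<2 ^ D} \<inter> {x. x \<notin> xor_span f S} = {..<2 ^ D} - xor_span f S" by auto
    then show "(\<Sum>x<2 ^ D. of_bool (x \<notin> xor_span f S)) = 2 ^ D - real (card (xor_span f S))"
      using card_mono[OF _ W] finite_subset[OF W]
      by (simp add: sum_of_bool_eq card_Diff_subset W of_nat_diff)
  qed
  also have "(\<Sum>T\<in>?P (Suc m). \<Sum>x<2 ^ D. of_bool (x \<in> xor_span f T)) =
      (\<Sum>T\<in>?P (Suc m). real (card (xor_span f T)))"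
  proof (rule sum.cong[OF refl])
    fix T assume "T \<in> ?P (Suc m)"
    then have W: "xor_span f T \<subseteq> {..<2 ^ D}" using xor_span_labelling_subset[OF f] by auto
    then have "{..<2 ^ D} \<inter> {x. x \<in> xor_span f T} = xor_span f T" by auto
    then show "(\<Sum>x<2 ^ D. of_bool (x \<in> xor_span f T)) = real (card (xor_span f T))"
      by (simp add: sum_of_bool_eq)
  qed
  finally show ?thesis .
qed

text \<open>\<open>La\<close> bounds the size of every family, hence also the average over all pairs
  \<open>(f, x)\<close>; the computation is scaled by the number of pairs. Both \<open>m\<close> and
  \<open>D\<close> are still free.\<close>

lemma La_crown_ge:
  "real (La n UNIV O6) \<ge> (n choose m) * (1 - mean_density D m) + (n choose Suc m) * mean_density D (Suc m)"
proof -
  let ?L = "labellings n D"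
  let ?P = "\<lambda>k. {S. S \<subseteq> {1..n} \<and> card S = k}"
  have cP: "card (?P k) = n choose k" for k
    using n_subsets[of "{1..n}" k] by simp
  have "card ?L * 2 ^ D * ((n choose m) * (1 - mean_density D m) + (n choose Suc m) * mean_density D (Suc m))
      = (\<Sum>S\<in>?P m. \<Sum>f\<in>?L. 2 ^ D - real (card (xor_span f S))) +
        (\<Sum>T\<in>?P (Suc m). \<Sum>f\<in>?L. real (card (xor_span f T)))"
  proof -
    have "(\<Sum>S\<in>?P m. \<Sum>f\<in>?L. 2 ^ D - real (card (xor_span f S))) =
        (\<Sum>S\<in>?P m. card ?L * 2 ^ D * (1 - mean_density D m))"
      by (rule sum.cong) (auto simp: sum_subtractf sum_card_span algebra_simps)
    moreover have "(\<Sum>T\<in>?P (Suc m). \<Sum>f\<in>?L. real (card (xor_span f T))) =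
        (\<Sum>T\<in>?P (Suc m). card ?L * 2 ^ D * mean_density D (Suc m))"
      by (rule sum.cong) (auto simp: sum_card_span)
    ultimately show ?thesis by (simp only: sum_constant cP) (simp add: algebra_simps)
  qed
  also have "\<dots> = (\<Sum>f\<in>?L. \<Sum>S\<in>?P m. 2 ^ D - real (card (xor_span f S))) +
        (\<Sum>f\<in>?L. \<Sum>T\<in>?P (Suc m). real (card (xor_span f T)))"
    by (intro arg_cong2[where f = "(+)"] sum.swap)
  also have "\<dots> = (\<Sum>f\<in>?L. \<Sum>x<2 ^ D. real (card (crown_free_family n m f x)))"
    unfolding sum.distrib[symmetric]
    by (intro sum.cong sum_card_crown_free_family[symmetric]) auto
  also have "\<dots> \<le> (\<Sum>f\<in>?L. \<Sum>x<2 ^ D :: nat. real (La n UNIV O6))"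
    by (intro sum_mono of_nat_mono card_le_La weak_free_crown_free_family)
      (auto simp: crown_free_family_def)
  also have "\<dots> = card ?L * 2 ^ D * real (La n UNIV O6)" by simp
  finally show ?thesis using labellings_nonempty[of n D] by simp
qed

section \<open>Asymptotics\<close>

lemma gauss_binom2_eq_0: "t < a \<Longrightarrow> gauss_binom2 t a = 0"
  by (induction t a rule: gauss_binom2.induct) auto

lemma two_power_Suc_minus_1_nonzero: "2 ^ Suc i - 1 \<noteq> (0 :: real)"
  using one_less_power[of "2 :: real" "Suc i"] by simp

text \<open>The product runs over \<open>s\<close> rather than \<open>a\<close> factors, so its
  length stays fixed when \<open>s\<close> is fixed and \<open>a\<close> grows.\<close>

lemma gauss_binom2_eq_prod:
  "gauss_binom2 (a + s) a = (\<Prod>i<s. (2 ^ (a + Suc i) - 1) / (2 ^ Suc i - 1))"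
proof (induction "a + s" arbitrary: a s)
  case 0
  then show ?case by simp
next
  case (Suc t)
  note nz = two_power_Suc_minus_1_nonzero
  show ?case
  proof (cases a)
    case 0
    then show ?thesis using nz by simp
  next
    case a: (Suc b)
    show ?thesis
    proof (cases s)
      case 0
      then show ?thesis
        using Suc.hyps(1)[of b 0] Suc.hyps(2) a by (simp add: gauss_binom2_eq_0)
    next
      case s: (Suc r)
      define X :: real where "X = (\<Prod>i<r. (2 ^ (Suc b + Suc i) - 1) / (2 ^ Suc i - 1))"
      have 1: "gauss_binom2 (Suc b + r) (Suc b) = X"
        using Suc.hyps a s unfolding X_def by (intro Suc.hyps(1)) simp
      have "gauss_binom2 (b + Suc r) b = (\<Prod>i<Suc r. (2 ^ (b + Suc i) - 1) / (2 ^ Suc i - 1))"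
        using Suc.hyps a s by (intro Suc.hyps(1)) simp
      also have "\<dots> = (\<Prod>i<Suc r. 2 ^ (b + Suc i) - 1) / (\<Prod>i<Suc r. 2 ^ Suc i - 1)"
        by (rule prod_dividef)
      also have "(\<Prod>i<Suc r. 2 ^ (b + Suc i) - 1 :: real) =
          (2 ^ Suc b - 1) * (\<Prod>i<r. 2 ^ (Suc b + Suc i) - 1)"
        by (subst prod.lessThan_Suc_shift) simp
      also have "(2 ^ Suc b - 1) * (\<Prod>i<r. 2 ^ (Suc b + Suc i) - 1) / (\<Prod>i<Suc r. 2 ^ Suc i - 1) =
          X * ((2 ^ Suc b - 1) / (2 ^ Suc r - 1))"
        by (simp add: X_def prod_dividef)
      finally have 2: "gauss_binom2 (b + Suc r) b = X * ((2 ^ Suc b - 1) / (2 ^ Suc r - 1))" .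
      have "gauss_binom2 (a + s) a = 2 ^ Suc b * X + X * ((2 ^ Suc b - 1) / (2 ^ Suc r - 1))"
        using 1 2 a s by simp
      \<comment> \<open>Both terms of the recurrence are multiples of \<open>X\<close>; their
        coefficients combine by
        \<open>2 ^ a * (2 ^ s - 1) + (2 ^ a - 1) = 2 ^ (a + s) - 1\<close>.\<close>
      also have "\<dots> = X * ((2 ^ (a + s) - 1) / (2 ^ Suc r - 1))"
        using nz[of r] a s by (simp add: field_simps power_add)
      also have "\<dots> = (\<Prod>i<s. (2 ^ (a + Suc i) - 1) / (2 ^ Suc i - 1))"
        using a s by (simp add: X_def)
      finally show ?thesis .
    qed
  qed
qed

text \<open>The contribution of rank \<open>a\<close> to \<open>density_gain (Suc m) m\<close> for \<open>m = a + s\<close>, that is, of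
  codimension \<open>s + 1\<close>.\<close>

definition gain_term :: "nat \<Rightarrow> nat \<Rightarrow> real" where
  "gain_term s a =
    rank_prob (Suc (a + s)) (a + s) a * (2 ^ a / 2 ^ Suc (a + s) * (1 - 2 ^ a / 2 ^ Suc (a + s)))"

text \<open>The denominator splits into \<open>2 ^ (D * s)\<close>, which scales the Gaussian
  binomial, and \<open>2 ^ (D * a)\<close>, which turns the other product into a quotient of partial
  products of \<open>Delta2\<close>.\<close>

lemma rank_prob_square:
  "rank_prob (Suc (a + s)) (a + s) a =
    (\<Prod>i<s. (2 ^ Suc i / 2 ^ Suc s - 1 / 2 ^ (a + Suc s)) / (2 ^ Suc i - 1)) *
    ((\<Prod>i<a + Suc s. 1 - 1 / 2 ^ Suc i) / (\<Prod>i<Suc s. 1 - 1 / 2 ^ Suc i))"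
proof -
  let ?D = "Suc (a + s)"
  have "(\<Prod>i<a. 2 ^ ?D - 2 ^ i :: real) / 2 ^ (?D * a) = (\<Prod>i<a. (2 ^ ?D - 2 ^ i) / 2 ^ ?D)"
    by (simp only: prod_dividef prod_constant card_lessThan power_mult)
  \<comment> \<open>Reversed, the exponents start at \<open>s + 2\<close>, just after those of the
    first \<open>Suc s\<close> factors.\<close>
  also have "\<dots> = (\<Prod>i<a. (2 ^ ?D - 2 ^ (a - Suc i)) / 2 ^ ?D)"
    by (rule prod.nat_diff_reindex[symmetric])
  also have "\<dots> = (\<Prod>i<a. 1 - 1 / 2 ^ Suc (Suc s + i))"
  proof (rule prod.cong[OF refl])
    fix i assume "i \<in> {..<a}"
    then have "?D = (a - Suc i) + Suc (Suc s + i)" by auto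
    then have "(2 :: real) ^ ?D = 2 ^ (a - Suc i) * 2 ^ Suc (Suc s + i)"
      by (metis power_add)
    then show "(2 ^ ?D - 2 ^ (a - Suc i)) / 2 ^ ?D = (1 - 1 / 2 ^ Suc (Suc s + i) :: real)"
      by (simp add: field_simps)
  qed
  also have "\<dots> = (\<Prod>i<a + Suc s. 1 - 1 / 2 ^ Suc i) / (\<Prod>i<Suc s. 1 - 1 / 2 ^ Suc i)"
  proof -
    have "(\<Prod>i<Suc s + a. 1 - 1 / 2 ^ Suc i :: real) =
        (\<Prod>i<Suc s. 1 - 1 / 2 ^ Suc i) * (\<Prod>i<a. 1 - 1 / 2 ^ Suc (Suc s + i))"
      by (induction a) simp_all
    moreover have "(\<Prod>i<Suc s. 1 - 1 / 2 ^ Suc i :: real) \<noteq> 0"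
      using two_power_Suc_minus_1_nonzero by (auto simp: field_simps)
    ultimately show ?thesis by (simp add: add.commute del: prod.lessThan_Suc)
  qed
  finally have 1: "(\<Prod>i<a. 2 ^ ?D - 2 ^ i :: real) / 2 ^ (?D * a) =
    (\<Prod>i<a + Suc s. 1 - 1 / 2 ^ Suc i) / (\<Prod>i<Suc s. 1 - 1 / 2 ^ Suc i)" .
  have "gauss_binom2 (a + s) a / 2 ^ (?D * s) =
      (\<Prod>i<s. (2 ^ (a + Suc i) - 1) / (2 ^ Suc i - 1) / 2 ^ ?D)"
    by (simp only: gauss_binom2_eq_prod prod_dividef prod_constant card_lessThan power_mult)
  also have "\<dots> = (\<Prod>i<s. (2 ^ Suc i / 2 ^ Suc s - 1 / 2 ^ (a + Suc s)) / (2 ^ Suc i - 1))"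
    by (rule prod.cong) (simp_all add: field_simps power_add)
  finally have 2: "gauss_binom2 (a + s) a / 2 ^ (?D * s) = \<dots>" .
  have "rank_prob ?D (a + s) a =
      gauss_binom2 (a + s) a / 2 ^ (?D * s) * ((\<Prod>i<a. 2 ^ ?D - 2 ^ i) / 2 ^ (?D * a))"
    unfolding rank_prob_def distrib_left power_add by simp
  then show ?thesis unfolding 1 2 .
qed

section \<open>The constant of the theorem and the limits that produce it\<close>

lemma prod_Delta2_tendsto: "(\<lambda>k. \<Prod>i<k. 1 - 1 / 2 ^ Suc i) \<longlonglongrightarrow> Delta2"
proof -
  have "summable (\<lambda>i. \<bar>- (1 / 2 ^ Suc i)\<bar> :: real)"
    using summable_geometric[of "1 / 2 :: real"]
    by (subst summable_Suc_iff[where f = "\<lambda>i. \<bar>- (1 / 2 ^ i)\<bar>"]) (simp add: power_divide)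
  then have "convergent_prod (\<lambda>i. 1 + - (1 / 2 ^ Suc i) :: real)"
    by (rule summable_imp_convergent_prod_real)
      (use two_power_Suc_minus_1_nonzero in \<open>auto simp: field_simps\<close>)
  then have "(\<lambda>k. \<Prod>i\<le>k. 1 - 1 / 2 ^ Suc i) \<longlonglongrightarrow> Delta2"
    unfolding Delta2_def using convergent_prod_LIMSEQ by fastforce
  then show ?thesis
    by (subst (asm) lessThan_Suc_atMost[symmetric]) (rule LIMSEQ_imp_Suc)
qed

text \<open>Six factors are computed exactly; the rest have product at least 1 minus the sum 1/64 of
  the omitted powers. The extra \<open>1 / 2 ^ (6 + k)\<close> is the part of that sum not yet used,
  which makes the induction work.\<close>

lemma Delta2_ge: "Delta2 \<ge> 0.2885"
proof (rule LIMSEQ_le_const[OF prod_Delta2_tendsto])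
  let ?P = "\<lambda>k. \<Prod>i<k. 1 - 1 / 2 ^ Suc i :: real"
  have "?P (6 + k) \<ge> ?P 6 * (1 - 1 / 64 + 1 / 2 ^ (6 + k))" for k
  proof (induction k)
    case 0
    show ?case by simp
  next
    case (Suc k)
    define y :: real where "y = 1 / 2 ^ (6 + k)"
    have P6: "?P 6 \<ge> 0" by (simp add: eval_nat_numeral)
    have y: "y \<ge> 0" "y \<le> 1 / 64"
      unfolding y_def by (simp_all add: power_add field_simps)
    have "?P 6 * (1 - 1 / 64 + y / 2) \<le> ?P 6 * ((1 - 1 / 64 + y) * (1 - y / 2))"
    proof (intro mult_left_mono P6)
      have "y * y \<le> 1 / 64 * y" using y by (intro mult_right_mono)
      then show "1 - 1 / 64 + y / 2 \<le> (1 - 1 / 64 + y) * (1 - y / 2)"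
        by (simp add: field_simps)
    qed
    also have "\<dots> \<le> ?P (6 + k) * (1 - y / 2)"
      unfolding mult.assoc[symmetric]
      using Suc.IH y by (intro mult_right_mono) (simp_all add: y_def)
    also have "y / 2 = 1 / 2 ^ Suc (6 + k)"
      by (simp only: y_def power_Suc divide_divide_eq_left mult.commute)
    finally show ?case unfolding add_Suc_right prod.lessThan_Suc .
  qed
  moreover have "?P 6 * (1 - 1 / 64 + 1 / 2 ^ (6 + k)) \<ge> 0.2885" for k
  proof -
    have "?P 6 * (1 - 1 / 64) \<le> ?P 6 * (1 - 1 / 64 + 1 / 2 ^ (6 + k))"
      by (intro mult_left_mono) (simp_all add: eval_nat_numeral)
    moreover have "?P 6 * (1 - 1 / 64) \<ge> 0.2885" by (simp add: eval_nat_numeral)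
    ultimately show ?thesis by linarith
  qed
  ultimately have "?P (6 + k) \<ge> 0.2885" for k by (meson order_trans)
  then show "\<exists>N. \<forall>k\<ge>N. 0.2885 \<le> ?P k"
    by (intro exI[of _ 6]) (metis le_Suc_ex)
qed

text \<open>The series summand for j = s + 1, with the product index shifted to start at 0.\<close>

definition crown_term :: "nat \<Rightarrow> real" where
  "crown_term s = 1 / 2 ^ Suc s / (\<Prod>i<s. 2 ^ Suc i - 1)\<^sup>2"

lemma crown_term_nonneg: "crown_term s \<ge> 0"
  by (simp add: crown_term_def)

lemma summable_crown_term: "summable crown_term"
proof (rule summable_comparison_test)
  show "summable (\<lambda>s. 1 / 2 ^ Suc s :: real)"
    using summable_geometric[of "1 / 2 :: real"]
    by (subst summable_Suc_iff[where f = "\<lambda>i. 1 / 2 ^ i"]) (simp add: power_divide)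
  have "1 \<le> (\<Prod>i<s. 2 ^ Suc i - 1 :: real)" for s
    by (rule prod_ge_1) (use one_le_power[of "2 :: real"] in auto)
  then have ge1: "1 \<le> (\<Prod>i<s. 2 ^ Suc i - 1 :: real)\<^sup>2" for s
    by (rule one_le_power)
  have "crown_term s \<le> 1 / 2 ^ Suc s / 1" for s
    unfolding crown_term_def
  proof (rule divide_left_mono[OF ge1])
    show "0 < (\<Prod>i<s. 2 ^ Suc i - 1 :: real)\<^sup>2 * 1"
      using ge1[of s] by linarith
  qed simp
  then show "\<exists>N. \<forall>s\<ge>N. norm (crown_term s) \<le> 1 / 2 ^ Suc s"
    using crown_term_nonneg by simp
qed

lemma crown_const_eq: "crown_const = Delta2 * (\<Sum>s. crown_term s)"
  by (simp add: crown_const_def crown_term_def prod.atLeast1_atMost_eq)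

lemma crown_const_gt: "crown_const > 0.22"
proof -
  \<comment> \<open>The terms are 1/2, 1/4 and 1/72. The first two alone would give only about 0.217
    after multiplication by \<open>Delta2\<close>.\<close>
  have "0.7638 \<le> (\<Sum>s<3. crown_term s)"
    by (simp add: crown_term_def eval_nat_numeral)
  also have "\<dots> \<le> (\<Sum>s. crown_term s)"
    by (intro sum_le_suminf summable_crown_term) (auto simp: crown_term_nonneg)
  finally have "0.2885 * 0.7638 \<le> Delta2 * (\<Sum>s. crown_term s)"
    using Delta2_ge by (intro mult_mono) auto
  then show ?thesis by (simp add: crown_const_eq)
qed

text \<open>For fixed \<open>s\<close>, the variable \<open>a\<close> enters only through
  \<open>1 / 2 ^ (a + Suc s)\<close>, which vanishes, and a partial product tending to
  \<open>Delta2\<close>. The rest is an identity in \<open>s\<close>.\<close>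

lemma gain_term_tendsto: "gain_term s \<longlonglongrightarrow> Delta2 * crown_term s"
proof -
  let ?P = "\<lambda>k. \<Prod>i<k. 1 - 1 / 2 ^ Suc i :: real"
  let ?Q = "\<Prod>i<s. 2 ^ Suc i - 1 :: real"
  let ?R = "\<Prod>i<s. 2 ^ Suc i :: real"
  note nz = two_power_Suc_minus_1_nonzero
  have "(\<lambda>a. (1 / 2) ^ (a + Suc s)) \<longlonglongrightarrow> (0 :: real)"
    using LIMSEQ_power_zero[of "1 / 2 :: real"] by (intro LIMSEQ_ignore_initial_segment) simp
  then have pow: "(\<lambda>a. 1 / 2 ^ (a + Suc s)) \<longlonglongrightarrow> (0 :: real)"
    by (simp only: power_divide power_one)
  have PS: "?P (Suc s) \<noteq> 0"
    using nz by (auto simp: field_simps)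
  have "gain_term s = (\<lambda>a.
      (\<Prod>i<s. (2 ^ Suc i / 2 ^ Suc s - 1 / 2 ^ (a + Suc s)) / (2 ^ Suc i - 1)) *
      (?P (a + Suc s) / ?P (Suc s)) * (1 / 2 ^ Suc s * (1 - 1 / 2 ^ Suc s)))"
  proof
    fix a
    have "2 ^ a / 2 ^ Suc (a + s) = (1 / 2 ^ Suc s :: real)" by (simp add: power_add)
    then show "gain_term s a =
        (\<Prod>i<s. (2 ^ Suc i / 2 ^ Suc s - 1 / 2 ^ (a + Suc s)) / (2 ^ Suc i - 1)) *
        (?P (a + Suc s) / ?P (Suc s)) * (1 / 2 ^ Suc s * (1 - 1 / 2 ^ Suc s))"
      unfolding gain_term_def rank_prob_square by simp
  qed
  moreover have "(\<lambda>a. (\<Prod>i<s. (2 ^ Suc i / 2 ^ Suc s - 1 / 2 ^ (a + Suc s)) / (2 ^ Suc i - 1)) *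
      (?P (a + Suc s) / ?P (Suc s)) * (1 / 2 ^ Suc s * (1 - 1 / 2 ^ Suc s)))
    \<longlonglongrightarrow> (\<Prod>i<s. (2 ^ Suc i / 2 ^ Suc s - 0) / (2 ^ Suc i - 1)) *
      (Delta2 / ?P (Suc s)) * (1 / 2 ^ Suc s * (1 - 1 / 2 ^ Suc s))"
    by (intro tendsto_intros pow nz PS LIMSEQ_ignore_initial_segment prod_Delta2_tendsto)
  moreover have "(\<Prod>i<s. (2 ^ Suc i / 2 ^ Suc s - 0) / (2 ^ Suc i - 1)) *
      (Delta2 / ?P (Suc s)) * (1 / 2 ^ Suc s * (1 - 1 / 2 ^ Suc s)) = Delta2 * crown_term s"
  proof -
    \<comment> \<open>\<open>?R\<close> is 2 to the power s(s+1)/2; its square cancels the powers of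
      two, leaving \<open>?Q\<close> squared in the denominator.\<close>
    have R2: "?R * ?R = (2 ^ Suc s) ^ s"
    proof (induction s)
      case (Suc s)
      have "(\<Prod>i<Suc s. 2 ^ Suc i :: real) * (\<Prod>i<Suc s. 2 ^ Suc i) =
          (2 ^ Suc s) ^ s * (2 ^ Suc s * 2 ^ Suc s)"
        unfolding Suc.IH[symmetric] prod.lessThan_Suc by (simp only: mult_ac)
      also have "\<dots> = 2 ^ (Suc s * s + (Suc s + Suc s))"
        by (simp only: power_mult power_add)
      also have "Suc s * s + (Suc s + Suc s) = Suc (Suc s) * Suc s" by simp
      finally show ?case by (simp only: power_mult)
    qed simp
    have A: "(\<Prod>i<s. (2 ^ Suc i / 2 ^ Suc s - 0) / (2 ^ Suc i - 1 :: real)) = ?R / (2 ^ Suc s) ^ s / ?Q"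
      by (simp only: diff_0_right prod_dividef prod_constant card_lessThan)
    have "?P s = (\<Prod>i<s. (2 ^ Suc i - 1) / 2 ^ Suc i)"
      by (rule prod.cong) (simp_all add: field_simps)
    then have B: "?P s = ?Q / ?R" by (simp only: prod_dividef)
    have C: "?P (Suc s) = ?Q / ?R * (1 - 1 / 2 ^ Suc s)"
      unfolding prod.lessThan_Suc B ..
    have Q: "?Q \<noteq> 0" using nz by simp
    have R: "?R \<noteq> 0" by simp
    have E: "1 - 1 / 2 ^ Suc s \<noteq> (0 :: real)" using nz[of s] by (simp add: field_simps)
    have "?R / (2 ^ Suc s) ^ s / ?Q * (Delta2 / (?Q / ?R * (1 - 1 / 2 ^ Suc s))) *
        (1 / 2 ^ Suc s * (1 - 1 / 2 ^ Suc s)) = Delta2 * (1 / 2 ^ Suc s / ?Q\<^sup>2)"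
      unfolding R2[symmetric] using Q R E by (simp add: power2_eq_square field_simps)
    then show ?thesis unfolding A C crown_term_def .
  qed
  ultimately show ?thesis by (simp only:)
qed

section \<open>The lower bound for \<open>La\<close> and its limit\<close>

lemma density_gain_ge:
  assumes "J \<le> Suc m"
  shows "density_gain (Suc m) m \<ge> (\<Sum>s<J. gain_term s (m - s))"
proof -
  let ?g = "\<lambda>a. rank_prob (Suc m) m a * (2 ^ a / 2 ^ Suc m * (1 - 2 ^ a / 2 ^ Suc m))"
  have "(\<Sum>s<J. gain_term s (m - s)) = (\<Sum>s<J. ?g (m - s))"
    using assms by (intro sum.cong) (auto simp: gain_term_def)
  \<comment> \<open>The bound \<open>J \<le> Suc m\<close> keeps the truncated subtraction
    \<open>m - s\<close> injective.\<close>
  also have "\<dots> = (\<Sum>a\<in>(\<lambda>s. m - s) ` {..<J}. ?g a)"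
    using assms by (subst sum.reindex) (auto simp: inj_on_def)
  also have "\<dots> \<le> (\<Sum>a\<le>m. ?g a)"
  proof (rule sum_mono2)
    fix a assume "a \<in> {..m} - (\<lambda>s. m - s) ` {..<J}"
    then have "a \<le> Suc m" by simp
    then have "(2 :: real) ^ a \<le> 2 ^ Suc m" by (rule power_increasing) simp
    then have "(2 :: real) ^ a / 2 ^ Suc m \<le> 1" by simp
    then show "0 \<le> ?g a"
      using \<open>a \<le> Suc m\<close> by (intro mult_nonneg_nonneg rank_prob_nonneg) auto
  qed auto
  finally show ?thesis by (simp add: density_gain_def)
qed

text \<open>Here \<open>D = m + 1\<close> is chosen. With both levels weighted equally,
  \<open>?q\<close> cancels from \<open>(1 - ?q) + (?q + ?\<delta>)\<close>; the factor
  \<open>m / (m + 1)\<close> pays for the possibly smaller upper level.\<close>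

lemma La_crown_ge_gain:
  fixes n :: nat
  defines "m \<equiv> n div 2"
  assumes "J \<le> Suc m"
  shows "real (La n UNIV O6) \<ge>
    real m / real (Suc m) * (1 + (\<Sum>s<J. gain_term s (m - s))) * (n choose m)"
proof -
  let ?C = "real (n choose m)"
  let ?\<rho> = "real m / real (Suc m)"
  let ?q = "mean_density (Suc m) m" and ?\<delta> = "density_gain (Suc m) m"
  have q': "?q + ?\<delta> \<ge> 0"
    unfolding mean_density_Suc[symmetric] unfolding mean_density_def
    by (intro sum_nonneg mult_nonneg_nonneg rank_prob_nonneg) auto
  have "Suc m * (n choose Suc m) = (n - m) * (n choose m)"
    using binomial_absorb_comp[of n m] binomial_absorption[of m n] by (metis mult.commute)
  moreover have "m * (n choose m) \<le> (n - m) * (n choose m)"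
    by (intro mult_right_mono) (auto simp: m_def)
  ultimately have "m * (n choose m) \<le> Suc m * (n choose Suc m)" by simp
  then have "real m * ?C \<le> real (Suc m) * real (n choose Suc m)"
    by (metis of_nat_le_iff of_nat_mult)
  then have \<rho>: "?\<rho> * ?C \<le> real (n choose Suc m)"
    by (simp add: field_simps)
  have "?\<rho> * (1 + (\<Sum>s<J. gain_term s (m - s))) * ?C \<le> ?\<rho> * (1 + ?\<delta>) * ?C"
    using density_gain_ge[OF assms(2)] by (intro mult_right_mono mult_left_mono) auto
  also have "\<dots> = ?\<rho> * (?C * (1 - ?q)) + ?\<rho> * ?C * (?q + ?\<delta>)"
    by (simp only: algebra_simps mult_1_left mult_1_right)
  \<comment> \<open>Both \<open>1 - ?q\<close> and \<open>?q + ?\<delta>\<close> are nonnegative, so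
    their coefficients may be enlarged.\<close>
  also have "\<dots> \<le> 1 * (?C * (1 - ?q)) + real (n choose Suc m) * (?q + ?\<delta>)"
    using mean_density_le_1[of "Suc m" m] \<rho> q'
    by (intro add_mono mult_right_mono) auto
  also have "\<dots> \<le> real (La n UNIV O6)"
    using La_crown_ge[of n m "Suc m"] by (simp add: mean_density_Suc)
  finally show ?thesis .
qed

text \<open>The order of limits matters: a finite \<open>J\<close> is fixed first, bringing the
  partial series close to the constant, and only then \<open>n\<close> grows. This avoids any
  uniformity in \<open>s\<close>.\<close>

lemma La_crown_asymptotic:
  assumes "e > 0"
  shows "\<forall>\<^sub>F n in sequentially.
    real (La n UNIV O6) / real (n choose (n div 2)) \<ge> 1 + crown_const - e"
proof -
  have "(\<lambda>J. Delta2 * (\<Sum>s<J. crown_term s)) \<longlonglongrightarrow> crown_const"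
    unfolding crown_const_eq by (intro tendsto_intros summable_LIMSEQ summable_crown_term)
  then have "\<forall>\<^sub>F J in sequentially. Delta2 * (\<Sum>s<J. crown_term s) > crown_const - e"
    using assms by (intro order_tendstoD) auto
  then obtain J where J: "Delta2 * (\<Sum>s<J. crown_term s) > crown_const - e"
    by (auto simp: eventually_at_top_linorder)
  have half: "filterlim (\<lambda>n. n div 2) at_top (sequentially :: nat filter)"
    unfolding filterlim_at_top
  proof
    fix Z :: nat
    show "\<forall>\<^sub>F n in sequentially. Z \<le> n div 2"
      using eventually_ge_at_top[of "2 * Z"] by eventually_elim auto
  qed
  have "(\<lambda>m. real m / real (Suc m) * (1 + (\<Sum>s<J. gain_term s (m - s))))
      \<longlonglongrightarrow> 1 * (1 + (\<Sum>s<J. Delta2 * crown_term s))"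
    by (intro tendsto_intros LIMSEQ_n_over_Suc_n
        filterlim_compose[OF gain_term_tendsto filterlim_minus_const_nat_at_top])
  then have "\<forall>\<^sub>F m in sequentially.
      real m / real (Suc m) * (1 + (\<Sum>s<J. gain_term s (m - s))) > 1 + crown_const - e"
    by (rule order_tendstoD) (use J in \<open>simp add: sum_distrib_left\<close>)
  then have "\<forall>\<^sub>F m in sequentially. J \<le> Suc m \<and>
      real m / real (Suc m) * (1 + (\<Sum>s<J. gain_term s (m - s))) > 1 + crown_const - e"
    using eventually_ge_at_top[of J] by eventually_elim auto
  then have "\<forall>\<^sub>F n in sequentially. J \<le> Suc (n div 2) \<and>
      real (n div 2) / real (Suc (n div 2)) * (1 + (\<Sum>s<J. gain_term s (n div 2 - s)))
        > 1 + crown_const - e"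
    using half by (rule eventually_compose_filterlim)
  then show ?thesis
  proof eventually_elim
    case (elim n)
    have "n choose (n div 2) > 0" by (simp add: zero_less_binomial)
    then have "real (n div 2) / real (Suc (n div 2)) * (1 + (\<Sum>s<J. gain_term s (n div 2 - s)))
        \<le> real (La n UNIV O6) / real (n choose (n div 2))"
      using La_crown_ge_gain[of J n] elim by (simp add: pos_le_divide_eq)
    with elim show ?case by linarith
  qed
qed

theorem theorem1:
  "(\<exists>\<epsilon> :: nat \<Rightarrow> real. \<epsilon> \<in> o(\<lambda>_. 1) \<and>
      (\<forall>n. real (La n UNIV O6) \<ge> (1 + crown_const + \<epsilon> n) * real (n choose (n div 2)))) \<and>
   crown_const > 0.22"
proof (intro conjI exI allI)
  \<comment> \<open>Only a lower bound on the ratio is known, so the error is capped at 0 to make it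
    tend to 0.\<close>
  define \<epsilon> where "\<epsilon> n =
    min 0 (real (La n UNIV O6) / real (n choose (n div 2)) - 1 - crown_const)" for n
  have "\<epsilon> \<longlonglongrightarrow> 0"
  proof (rule order_tendstoI)
    fix e :: real assume "e < 0"
    then show "\<forall>\<^sub>F n in sequentially. e < \<epsilon> n"
      using La_crown_asymptotic[of "- e / 2"] by (auto elim!: eventually_mono simp: \<epsilon>_def)
  next
    fix e :: real assume "0 < e"
    then show "\<forall>\<^sub>F n in sequentially. \<epsilon> n < e" by (simp add: \<epsilon>_def min_def)
  qed
  then show "\<epsilon> \<in> o(\<lambda>_. 1)" by (intro smalloI_tendsto) auto
  fix n :: nat
  have "n choose (n div 2) > 0" by (simp add: zero_less_binomial)
  then have "(1 + crown_const +
      (real (La n UNIV O6) / real (n choose (n div 2)) - 1 - crown_const)) * real (n choose (n div 2))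
    = real (La n UNIV O6)" by simp
  moreover have "(1 + crown_const + \<epsilon> n) * real (n choose (n div 2)) \<le> (1 + crown_const +
      (real (La n UNIV O6) / real (n choose (n div 2)) - 1 - crown_const)) * real (n choose (n div 2))"
    by (intro mult_right_mono) (auto simp: \<epsilon>_def)
  ultimately show "(1 + crown_const + \<epsilon> n) * real (n choose (n div 2)) \<le> real (La n UNIV O6)"
    by simp
qed (rule crown_const_gt)

end
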